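(* Consider any circular 3G matching market of size $N=3$ (three women, three men and three dogs). Then there exists a stable matching. Furthermore, for any agent $x$ (of any of the three genders), there exists a stable matching in which either $x$ is $1$-content, or $x$'s favorite is $1$-content and $x$ is $2$-content.
   Context: A circular 3G matching market of size $N$ consists of three disjoint sets of agents (three "genders"), each of size $N$: women $a_1,\dots,a_N$, men $b_1,\dots,b_N$, and dogs $c_1,\dots,c_N$. Every woman has a strict linear preference order on the set of all $N$ men, every man has a strict linear preference order on the set of all $N$ dogs, and every dog has a strict linear preference order on the set of all $N$ women. These orders are arbitrary. The agent ranked as number $1$ by $x$ is called $x$'s favorite. A triple consists of one woman, one man and one dog. Agents compare triples containing themselves by the circular rule: a woman strictly prefers one triple to another if and only if she strictly prefers the man in the first to the man in the second; likewise, men compare triples only by the dog in them, and dogs only by the woman in them. A matching is a partition of all the agents into $N$ triples, each consisting of one woman, one man and one dog. A triple $T$ is a blocking triple for a matching if each of the three members of $T$ strictly prefers $T$ to the triple containing that member in the matching. A matching is stable if it has no blocking triple. Given a matching, an agent $x$ is $i$-content if the agent that $x$ ranks as number $i$ (among the agents of the gender $x$ cares about) belongs to the same triple of the matching as $x$. *)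

theory Defs
  imports "HOL-Library.Disjoint_Sets"
begin

text \<open>
  Agents of all three genders live in one type, the genders being disjoint subsets of it.
  A pair (y, z) in the relation of agent x means that x strictly prefers y to z.
\<close>

record 'v market =
  women :: "'v set"
  men :: "'v set"
  dogs :: "'v set"
  pref :: "'v \<Rightarrow> 'v rel"

definition agents :: "'v market \<Rightarrow> 'v set" where
  "agents G = women G \<union> men G \<union> dogs G"

text \<open>The gender ranked by an agent; meant only for arguments that are agents of the market.\<close>

definition ranked_gender :: "'v market \<Rightarrow> 'v \<Rightarrow> 'v set" where
  "ranked_gender G x =
     (if x \<in> women G then men G else if x \<in> men G then dogs G else women G)"

definition circular_market :: "nat \<Rightarrow> 'v market \<Rightarrow> bool" where
  "circular_market N G \<longleftrightarrow>
     finite (women G) \<and> finite (men G) \<and> finite (dogs G) \<and>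
     card (women G) = N \<and> card (men G) = N \<and> card (dogs G) = N \<and>
     women G \<inter> men G = {} \<and> men G \<inter> dogs G = {} \<and> women G \<inter> dogs G = {} \<and>
     (\<forall>x\<in>agents G. pref G x \<subseteq> ranked_gender G x \<times> ranked_gender G x \<and>
                   strict_linear_order_on (ranked_gender G x) (pref G x))"

definition rank :: "'v market \<Rightarrow> 'v \<Rightarrow> 'v \<Rightarrow> nat" where
  "rank G x y = card {z \<in> ranked_gender G x. (z, y) \<in> pref G x} + 1"

text \<open>
  Uniquely determined for 1 \<open>\<le>\<close> i \<open>\<le>\<close> N (lemma \<open>ranked_agent_unique\<close> below), unspecified
  for other values of i.
\<close>

definition ranked_agent :: "'v market \<Rightarrow> 'v \<Rightarrow> nat \<Rightarrow> 'v" where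
  "ranked_agent G x i = (THE y. y \<in> ranked_gender G x \<and> rank G x y = i)"

definition favorite :: "'v market \<Rightarrow> 'v \<Rightarrow> 'v" where
  "favorite G x = ranked_agent G x 1"

definition is_triple :: "'v market \<Rightarrow> 'v set \<Rightarrow> bool" where
  "is_triple G T \<longleftrightarrow> (\<exists>a\<in>women G. \<exists>b\<in>men G. \<exists>c\<in>dogs G. T = {a, b, c})"

definition prefers_triple :: "'v market \<Rightarrow> 'v \<Rightarrow> 'v set \<Rightarrow> 'v set \<Rightarrow> bool" where
  "prefers_triple G x S T \<longleftrightarrow>
     (\<exists>y \<in> S \<inter> ranked_gender G x. \<exists>z \<in> T \<inter> ranked_gender G x. (y, z) \<in> pref G x)"

definition is_matching :: "'v market \<Rightarrow> 'v set set \<Rightarrow> bool" where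
  "is_matching G P \<longleftrightarrow>
     partition_on (agents G) P \<and> card P = card (women G) \<and> (\<forall>T\<in>P. is_triple G T)"

definition blocking_triple :: "'v market \<Rightarrow> 'v set set \<Rightarrow> 'v set \<Rightarrow> bool" where
  "blocking_triple G P T \<longleftrightarrow>
     is_triple G T \<and> (\<forall>x\<in>T. \<exists>S\<in>P. x \<in> S \<and> prefers_triple G x T S)"

definition stable_matching :: "'v market \<Rightarrow> 'v set set \<Rightarrow> bool" where
  "stable_matching G P \<longleftrightarrow> is_matching G P \<and> (\<nexists>T. blocking_triple G P T)"

definition content :: "'v market \<Rightarrow> 'v set set \<Rightarrow> nat \<Rightarrow> 'v \<Rightarrow> bool" where
  "content G P i x \<longleftrightarrow> (\<exists>T\<in>P. x \<in> T \<and> ranked_agent G x i \<in> T)"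

lemma rank_bij:
  assumes "circular_market N G" "x \<in> agents G"
  shows "bij_betw (rank G x) (ranked_gender G x) {1..N}"
proof -
  let ?B = "ranked_gender G x" and ?r = "pref G x"
  have fin: "finite ?B" and card: "card ?B = N"
    using assms(1) by (auto simp: circular_market_def ranked_gender_def)
  have o: "trans ?r" "irrefl ?r" "total_on ?B ?r"
    using assms by (auto simp: circular_market_def strict_linear_order_on_def)
  have lt: "rank G x y < rank G x z" if "(y, z) \<in> ?r" "y \<in> ?B" for y z
  proof -
    have "{w \<in> ?B. (w, y) \<in> ?r} \<subset> {w \<in> ?B. (w, z) \<in> ?r}"
      using that o by (auto simp: irrefl_def dest: transD)
    then show ?thesis using fin by (simp add: rank_def psubset_card_mono)
  qed
  have inj: "inj_on (rank G x) ?B"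
    by (rule inj_onI) (metis lt o(3) less_irrefl total_on_def)
  have "rank G x ` ?B \<subseteq> {1..N}"
  proof clarsimp
    fix y assume y: "y \<in> ?B"
    then have "{w \<in> ?B. (w, y) \<in> ?r} \<subset> ?B" using o by (auto simp: irrefl_def)
    then have "card {w \<in> ?B. (w, y) \<in> ?r} < N" using fin card psubset_card_mono by metis
    then show "Suc 0 \<le> rank G x y \<and> rank G x y \<le> N" by (simp add: rank_def)
  qed
  moreover have "card (rank G x ` ?B) = card {1..N}"
    using inj card by (simp add: card_image)
  ultimately have "rank G x ` ?B = {1..N}" by (simp add: card_subset_eq)
  with inj show ?thesis by (simp add: bij_betw_def)
qed

lemma ranked_agent_unique:
  assumes "circular_market N G" "x \<in> agents G" "1 \<le> i" "i \<le> N"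
  shows "\<exists>!y. y \<in> ranked_gender G x \<and> rank G x y = i"
proof -
  have i: "i \<in> {1..N}" using assms by simp
  show ?thesis using rank_bij[OF assms(1,2)] i
    unfolding bij_betw_def inj_on_def by (metis (no_types, lifting) imageE)
qed

end

theory Submission
  imports Defs
begin

text \<open>
  Write f for the favorite map and follow \<open>x, b = f x, c = f b, a' = f c, b' = f a', c' = f b'\<close>.
  If one of \<open>a' = x\<close>, \<open>b' = b\<close>, \<open>c' = c\<close> holds, this path contains a triple whose members are all
  1-content. Put it into the matching; in the remaining market of size 2, give x (if it is still
  there) the partner it prefers, and that partner its own preferred one. Otherwise \<open>{x, b, c}\<close>,
  \<open>{a', b', c'}\<close> and the remaining agents form a matching in which the only two members of the first two
  genders that are not 1-content are already together, so no triple can block it.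
\<close>

text \<open>Used to set up a matching by choosing just two agents of each gender; the leftover agent
  gets index 2, so the third triple is forced.\<close>

lemma bij_betw_lessThan_3_ex:
  assumes "card A = 3" "x \<in> A" "y \<in> A" "x \<noteq> y"
  shows "\<exists>a. bij_betw a {..<3::nat} A \<and> a 0 = x \<and> a 1 = y"
proof -
  have fin: "finite A" using assms(1) by (simp add: card_ge_0_finite)
  then have "card (A - {x, y}) = 1" using assms by (simp add: card_Diff_subset)
  then obtain z where z: "A - {x, y} = {z}" by (auto simp: card_1_singleton_iff)
  define a where "a i = (if i = 0 then x else if i = 1 then y else z)" for i :: nat
  have "{..<3::nat} = {0, 1, 2}" by auto
  moreover have "A = {x, y, z}" "z \<noteq> x" "z \<noteq> y" using z assms by auto
  ultimately have "bij_betw a {..<3} A"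
    using assms(4) by (auto simp: bij_betw_def inj_on_def a_def)
  then show ?thesis by (auto simp: a_def)
qed

section \<open>Preference, rank and favorite of a single agent\<close>

context
  fixes N :: nat and G :: "'v market" and x :: 'v
  assumes market: "circular_market N G" and x: "x \<in> agents G"
begin

lemma pref_irrefl: "(y, y) \<notin> pref G x"
  using market x by (auto simp: circular_market_def strict_linear_order_on_def irrefl_def)

lemma pref_asym: "(y, z) \<in> pref G x \<Longrightarrow> (z, y) \<notin> pref G x"
  using market x pref_irrefl unfolding circular_market_def strict_linear_order_on_def
  by (blast dest: transD)

lemma pref_total:
  "y \<in> ranked_gender G x \<Longrightarrow> z \<in> ranked_gender G x \<Longrightarrow> y \<noteq> z \<Longrightarrow>
    (y, z) \<in> pref G x \<or> (z, y) \<in> pref G x"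
  using market x by (auto simp: circular_market_def strict_linear_order_on_def total_on_def)

lemma ranked_agent_eqI:
  assumes "1 \<le> i" "i \<le> N" "y \<in> ranked_gender G x" "rank G x y = i"
  shows "ranked_agent G x i = y"
  unfolding ranked_agent_def
  using ranked_agent_unique[OF market x assms(1,2)] assms(3,4) by (intro the1_equality) auto

lemma favorite_in:
  assumes "1 \<le> N"
  shows "favorite G x \<in> ranked_gender G x" and "rank G x (favorite G x) = 1"
  using theI'[OF ranked_agent_unique[OF market x order_refl assms]]
  by (simp_all add: favorite_def ranked_agent_def)

lemma favorite_best:
  assumes "1 \<le> N"
  shows "(z, favorite G x) \<notin> pref G x"
proof
  assume z: "(z, favorite G x) \<in> pref G x"
  \<comment> \<open>Rank 1 says only that the set of agents above the favorite has
    \<open>card\<close> 0; finiteness turns this into emptiness.\<close>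
  have "finite (ranked_gender G x)" using market by (auto simp: circular_market_def ranked_gender_def)
  then have "{z \<in> ranked_gender G x. (z, favorite G x) \<in> pref G x} = {}"
    using favorite_in(2)[OF assms] by (simp add: rank_def)
  moreover have "z \<in> ranked_gender G x" using z market x by (auto simp: circular_market_def)
  ultimately show False using z by auto
qed

text \<open>By \<open>best\<close> only the favorite can precede \<open>y\<close>, and by totality
  it does, so the set counted by \<open>rank\<close> is a singleton.\<close>

lemma ranked_agent_2_eqI:
  assumes "2 \<le> N" "y \<in> ranked_gender G x" "y \<noteq> favorite G x"
    and best: "\<And>z. z \<noteq> favorite G x \<Longrightarrow> (z, y) \<notin> pref G x"
  shows "ranked_agent G x 2 = y"
proof -
  have "1 \<le> N" using assms(1) by simp
  note fav = favorite_in(1)[OF this] favorite_best[OF this]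
  have "{z \<in> ranked_gender G x. (z, y) \<in> pref G x} = {favorite G x}"
    using fav best pref_total[OF fav(1) assms(2)] assms(3) by auto
  then have "rank G x y = 2" by (simp add: rank_def)
  then show ?thesis using assms by (intro ranked_agent_eqI) auto
qed

end

text \<open>The genders up to rotation, so that an agent of any gender may be taken from A.\<close>

locale rotated_market =
  fixes G :: "'v market" and A B C :: "'v set"
  assumes market: "circular_market 3 G"
    and rotation: "(A, B, C) \<in> {(women G, men G, dogs G), (men G, dogs G, women G),
                               (dogs G, women G, men G)}"
begin

lemma agents_eq: "agents G = A \<union> B \<union> C"
  using rotation by (auto simp: agents_def)

lemma in_agents: "x \<in> A \<Longrightarrow> x \<in> agents G" "x \<in> B \<Longrightarrow> x \<in> agents G" "x \<in> C \<Longrightarrow> x \<in> agents G"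
  by (auto simp: agents_eq)

lemma card_eq: "card A = 3" "card B = 3" "card C = 3" "card (women G) = 3"
  using rotation market by (auto simp: circular_market_def)

lemma disjoint: "A \<inter> B = {}" "B \<inter> C = {}" "A \<inter> C = {}"
  using rotation market by (auto simp: circular_market_def)

lemma ranked_gender_eq:
  "x \<in> A \<Longrightarrow> ranked_gender G x = B" "x \<in> B \<Longrightarrow> ranked_gender G x = C"
  "x \<in> C \<Longrightarrow> ranked_gender G x = A"
  using rotation market by (auto simp: circular_market_def ranked_gender_def)

text \<open>Triples are unordered sets, so rotating the genders does not change them.\<close>

lemma is_triple_iff: "is_triple G T \<longleftrightarrow> (\<exists>a\<in>A. \<exists>b\<in>B. \<exists>c\<in>C. T = {a, b, c})"
proof -
  have r: "{u, v, w} = {v, w, u}" "{u, v, w} = {w, u, v}" for u v w :: 'v by auto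
  show ?thesis using rotation r unfolding is_triple_def by fastforce
qed

lemma favorite_mem: "x \<in> A \<Longrightarrow> favorite G x \<in> B" "x \<in> B \<Longrightarrow> favorite G x \<in> C"
  "x \<in> C \<Longrightarrow> favorite G x \<in> A"
  using favorite_in(1)[OF market] by (auto simp: in_agents simp flip: ranked_gender_eq)

lemma not_pref_favorite: "x \<in> A \<union> B \<union> C \<Longrightarrow> (z, favorite G x) \<notin> pref G x"
  using favorite_best[OF market] by (simp add: agents_eq)

text \<open>Supplies the best partner once \<open>u\<close> has been taken by another triple: two
  candidates remain, and one comparison decides between them.\<close>

lemma most_preferred_ex:
  assumes "x \<in> agents G" "u \<in> ranked_gender G x"
  obtains y where "y \<in> ranked_gender G x" "y \<noteq> u"
    "\<And>z. z \<noteq> u \<Longrightarrow> (z, y) \<notin> pref G x"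
proof -
  let ?R = "ranked_gender G x"
  have "card ?R = 3" using assms(1) card_eq by (auto simp: agents_eq ranked_gender_eq)
  then have "card (?R - {u}) = 2" using assms(2) by simp
  then obtain v w where vw: "?R - {u} = {v, w}" "v \<noteq> w" by (auto simp: card_2_iff)
  then have mem: "v \<in> ?R" "w \<in> ?R" "v \<noteq> u" "w \<noteq> u" by auto
  have sub: "z \<in> ?R" if "(z, y) \<in> pref G x" for z y
    using that market assms(1) by (auto simp: circular_market_def)
  have or: "z = v \<or> z = w" if "z \<noteq> u" "(z, y) \<in> pref G x" for z y
    using sub[OF that(2)] that(1) vw(1) by auto
  note p = pref_irrefl[OF market assms(1)] pref_asym[OF market assms(1)]
    pref_total[OF market assms(1) mem(1,2) vw(2)]
  show thesis
  proof (cases "(v, w) \<in> pref G x")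
    case True
    show thesis by (rule that[of v]) (use mem True or p in blast)+
  next
    case False
    show thesis by (rule that[of w]) (use mem False or p in blast)+
  qed
qed

end

section \<open>Matchings given by indexing the three genders\<close>

locale indexed_market = rotated_market +
  fixes a b c :: "nat \<Rightarrow> 'a"
  assumes bij: "bij_betw a {..<3} A" "bij_betw b {..<3} B" "bij_betw c {..<3} C"
begin

definition triple :: "nat \<Rightarrow> 'a set" where
  "triple i = {a i, b i, c i}"

text \<open>Every matching has this form for suitable indexings, so a matching is built below by
  choosing three bijections.\<close>

definition diagonal :: "'a set set" where
  "diagonal = triple ` {..<3}"

lemma mem: "i < 3 \<Longrightarrow> a i \<in> A" "i < 3 \<Longrightarrow> b i \<in> B" "i < 3 \<Longrightarrow> c i \<in> C"
  using bij by (auto simp: bij_betw_def)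

lemma mem_triple_iff:
  assumes "i < 3" "j < 3"
  shows "a i \<in> triple j \<longleftrightarrow> i = j" "b i \<in> triple j \<longleftrightarrow> i = j" "c i \<in> triple j \<longleftrightarrow> i = j"
  using assms disjoint mem[OF assms(1)] mem[OF assms(2)] bij
  by (auto simp: triple_def bij_betw_def dest: inj_onD)

lemma exhaust:
  "y \<in> A \<Longrightarrow> \<exists>i<3. y = a i" "y \<in> B \<Longrightarrow> \<exists>i<3. y = b i" "y \<in> C \<Longrightarrow> \<exists>i<3. y = c i"
  using bij by (auto simp: bij_betw_def)

lemma triple_disjoint:
  assumes "i < 3" "j < 3" "i \<noteq> j"
  shows "triple i \<inter> triple j = {}"
  using mem_triple_iff[OF assms(1,2)] assms(3) by (auto simp: triple_def[of i])

lemma is_matching_diagonal: "is_matching G diagonal"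
proof -
  have "inj_on triple {..<3}"
    by (rule inj_onI) (metis lessThan_iff mem_triple_iff(1))
  then have "card diagonal = 3" by (simp add: diagonal_def card_image)
  moreover have "\<Union> diagonal = agents G"
    using mem exhaust by (force simp: diagonal_def triple_def agents_eq)
  moreover have "disjoint diagonal"
    using triple_disjoint unfolding disjoint_def diagonal_def by auto
  moreover have "{} \<notin> diagonal" by (auto simp: diagonal_def triple_def)
  moreover have "is_triple G T" if "T \<in> diagonal" for T
    using that mem unfolding diagonal_def triple_def is_triple_iff by blast
  ultimately show ?thesis by (simp add: is_matching_def partition_on_def card_eq)
qed

text \<open>A triple is given by the indices \<open>i\<close>, \<open>j\<close>, \<open>k\<close> of
  its members, and the current partners of these members carry the same indices. Blocking thus
  becomes three comparisons between indexed agents.\<close>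

lemma stable_diagonalI:
  assumes "\<And>i j k. \<lbrakk>i < 3; j < 3; k < 3; (b j, b i) \<in> pref G (a i); (c k, c j) \<in> pref G (b j);
                   (a i, a k) \<in> pref G (c k)\<rbrakk> \<Longrightarrow> False"
  shows "stable_matching G diagonal"
  unfolding stable_matching_def
proof (intro conjI notI is_matching_diagonal)
  assume "\<exists>T. blocking_triple G diagonal T"
  then obtain T where T: "blocking_triple G diagonal T" ..
  then obtain i j k where ijk: "i < 3" "j < 3" "k < 3" and T_eq: "T = {a i, b j, c k}"
    unfolding blocking_triple_def is_triple_iff using exhaust by metis
  \<comment> \<open>Blocking provides some triple of the matching that contains \<open>x\<close>;
    disjointness identifies it with \<open>triple l\<close>.\<close>
  have pr: "prefers_triple G x T (triple l)" if "x \<in> T" "x \<in> triple l" "l < 3" for x l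
  proof -
    obtain m where "m < 3" "x \<in> triple m" "prefers_triple G x T (triple m)"
      using T \<open>x \<in> T\<close> by (auto simp: blocking_triple_def diagonal_def)
    with triple_disjoint[of m l] that show ?thesis by (cases "m = l") auto
  qed
  have "T \<inter> A = {a i}" "T \<inter> B = {b j}" "T \<inter> C = {c k}"
    using mem(1)[OF ijk(1)] mem(2)[OF ijk(2)] mem(3)[OF ijk(3)] disjoint unfolding T_eq by blast+
  moreover have "triple l \<inter> A = {a l}" "triple l \<inter> B = {b l}" "triple l \<inter> C = {c l}" if "l < 3" for l
    using mem[OF that] disjoint unfolding triple_def by blast+
  ultimately have
    "(b j, b i) \<in> pref G (a i)" "(c k, c j) \<in> pref G (b j)" "(a i, a k) \<in> pref G (c k)"
    using pr[of "a i" i] pr[of "b j" j] pr[of "c k" k] ijk mem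
    by (simp_all add: prefers_triple_def ranked_gender_eq T_eq mem_triple_iff) (auto simp: triple_def)
  then show False using assms ijk by blast
qed

lemma content_diagonalI:
  assumes "i < 3" "x \<in> triple i" "ranked_agent G x n \<in> triple i"
  shows "content G diagonal n x"
  using assms by (auto simp: content_def diagonal_def)

lemma content_1_diagonalI:
  assumes "i < 3" "x \<in> triple i" "favorite G x \<in> triple i"
  shows "content G diagonal 1 x"
  using content_diagonalI[OF assms(1,2), of 1] assms(3) by (simp add: favorite_def)

lemma less_3_cases: "i < (3::nat) \<Longrightarrow> i = 0 \<or> i = 1 \<or> i = 2"
  by auto

lemma stable_diagonal_two_content:
  assumes fav: "\<And>i. i < 2 \<Longrightarrow> favorite G (a i) = b i" "\<And>i. i < 2 \<Longrightarrow> favorite G (b i) = c i"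
  shows "stable_matching G diagonal"
proof (rule stable_diagonalI)
  fix i j k :: nat
  assume ijk: "i < 3" "j < 3" "k < 3" and i: "(b j, b i) \<in> pref G (a i)"
    and j: "(c k, c j) \<in> pref G (b j)"
  have "\<not> i < 2" using i ijk mem not_pref_favorite[of "a i"] fav(1) by auto
  moreover have "\<not> j < 2" using j ijk mem not_pref_favorite[of "b j"] fav(2) by auto
  \<comment> \<open>Both indices are 2, so \<open>a 2\<close> would have to improve on
    \<open>b 2\<close> by receiving \<open>b 2\<close>.\<close>
  ultimately have "i = j" using ijk by auto
  then show False using i pref_irrefl[OF market] mem ijk in_agents by auto
qed

lemma stable_diagonal_favorite_cycle:
  assumes fav: "favorite G (a 0) = b 0" "favorite G (b 0) = c 0" "favorite G (c 0) = a 0"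
    and best: "(b 2, b 1) \<notin> pref G (a 1)" "(c 2, c 1) \<notin> pref G (b 1)"
  shows "stable_matching G diagonal"
proof (rule stable_diagonalI)
  fix i j k :: nat
  assume ijk: "i < 3" "j < 3" "k < 3" and i: "(b j, b i) \<in> pref G (a i)"
    and j: "(c k, c j) \<in> pref G (b j)" and k: "(a i, a k) \<in> pref G (c k)"
  have "i \<noteq> 0" using i ijk mem not_pref_favorite[of "a i"] fav(1) by (intro notI) auto
  moreover have "j \<noteq> 0" using j ijk mem not_pref_favorite[of "b j"] fav(2) by (intro notI) auto
  moreover have "k \<noteq> 0" using k ijk mem not_pref_favorite[of "c k"] fav(3) by (intro notI) auto
  moreover have "i \<noteq> j" "j \<noteq> k"
    using i j pref_irrefl[OF market] mem ijk in_agents by blast+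
  \<comment> \<open>Members of \<open>triple 0\<close> cannot improve, so the indices are 1 or 2 and
    \<open>(i, j, k)\<close> is (1, 2, 1) or (2, 1, 2). The first contradicts the choice of
    \<open>b 1\<close> for \<open>a 1\<close>, the second that of \<open>c 1\<close> for
    \<open>b 1\<close>.\<close>
  ultimately have "i = 1 \<and> j = 2 \<or> j = 1 \<and> k = 2" using less_3_cases ijk by metis
  then show False using i j best by auto
qed

end

section \<open>Construction of the matching for a given agent\<close>

context rotated_market
begin

definition nearly_content :: "'v set set \<Rightarrow> 'v \<Rightarrow> bool" where
  "nearly_content P x \<longleftrightarrow> content G P 1 x \<or> (content G P 1 (favorite G x) \<and> content G P 2 x)"

lemma favorite_cycle_nearly_content:
  assumes u: "u \<in> A" and cyc: "favorite G (favorite G (favorite G u)) = u" and "x \<in> A"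
  shows "\<exists>P. stable_matching G P \<and> nearly_content P x"
proof -
  define v w where "v = favorite G u" and "w = favorite G v"
  have vw: "v \<in> B" "w \<in> C" and fw: "favorite G w = u"
    using u cyc favorite_mem by (auto simp: v_def w_def)
  have "card (A - {u}) = 2" using u card_eq by simp
  then have "A - {u} \<noteq> {}" by (metis card.empty zero_neq_numeral)
  \<comment> \<open>If \<open>x\<close> lies outside the cycle, then \<open>x'\<close> is
    \<open>x\<close> itself; otherwise \<open>x'\<close> is any other agent of \<open>A\<close>. It
    chooses first in the remaining market.\<close>
  then obtain x' where x': "x' \<in> A" "x' \<noteq> u" "x = u \<or> x = x'" using \<open>x \<in> A\<close> by blast
  obtain y where y: "y \<in> B" "y \<noteq> v" "\<And>z. z \<noteq> v \<Longrightarrow> (z, y) \<notin> pref G x'"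
    using most_preferred_ex[of x' v] x'(1) vw in_agents by (auto simp: ranked_gender_eq)
  obtain t where t: "t \<in> C" "t \<noteq> w" "\<And>z. z \<noteq> w \<Longrightarrow> (z, t) \<notin> pref G y"
    using most_preferred_ex[of y w] y(1) vw in_agents by (auto simp: ranked_gender_eq)
  obtain a where a: "bij_betw a {..<3::nat} A" "a 0 = u" "a 1 = x'"
    using bij_betw_lessThan_3_ex[of A u x'] card_eq u x' by auto
  obtain b where b: "bij_betw b {..<3::nat} B" "b 0 = v" "b 1 = y"
    using bij_betw_lessThan_3_ex[of B v y] card_eq vw y by auto
  obtain c where c: "bij_betw c {..<3::nat} C" "c 0 = w" "c 1 = t"
    using bij_betw_lessThan_3_ex[of C w t] card_eq vw t by auto
  interpret indexed_market G A B C a b c by unfold_locales (fact a b c)+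
  \<comment> \<open>This makes the optimality of \<open>y\<close> and \<open>t\<close> applicable to
    the leftover agents \<open>b 2\<close> and \<open>c 2\<close>.\<close>
  have "b 2 \<noteq> v" "c 2 \<noteq> w"
    using b(1,2) c(1,2) by (auto simp: bij_betw_def dest: inj_onD)
  then have "stable_matching G diagonal"
    using a b c y(3) t(3) fw
    by (intro stable_diagonal_favorite_cycle) (auto simp: v_def w_def)
  moreover have "nearly_content diagonal x"
  proof (cases "x = u \<or> favorite G x = y")
    case True
    then have "content G diagonal 1 x"
      using content_1_diagonalI[of 0 u] content_1_diagonalI[of 1 x'] x' a b v_def
      by (auto simp: triple_def)
    then show ?thesis by (simp add: nearly_content_def)
  next
    case False
    then have x: "x = x'" "favorite G x \<noteq> y" using x' by auto
    \<comment> \<open>Only \<open>v\<close> can precede \<open>y\<close> in the order of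
      \<open>x\<close>, so a favorite other than \<open>y\<close> is \<open>v\<close>. Then
      \<open>y\<close> is ranked second, and \<open>v\<close> is together with its own favorite
      \<open>w\<close>.\<close>
    have fx: "favorite G x = v"
      using pref_total[OF market, of x y "favorite G x"] y x x'(1) favorite_mem(1)[of x]
        not_pref_favorite[of x y] in_agents by (auto simp: ranked_gender_eq)
    then have "ranked_agent G x 2 = y"
      using ranked_agent_2_eqI[OF market, of x y] y x x'(1) in_agents
      by (auto simp: ranked_gender_eq)
    then have "content G diagonal 2 x"
      using content_diagonalI[of 1 x 2] a b x by (simp add: triple_def)
    moreover have "content G diagonal 1 v"
      using content_1_diagonalI[of 0 v] b c w_def by (simp add: triple_def)
    ultimately show ?thesis by (simp add: nearly_content_def fx)
  qed
  ultimately show ?thesis by blast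
qed

lemma nearly_content_ex:
  assumes "x \<in> A"
  shows "\<exists>P. stable_matching G P \<and> nearly_content P x"
proof -
  define v w x' v' w' where "v = favorite G x" and "w = favorite G v" and "x' = favorite G w"
    and "v' = favorite G x'" and "w' = favorite G v'"
  note defs = v_def w_def x'_def v'_def w'_def
  have mem: "v \<in> B" "w \<in> C" "x' \<in> A" "v' \<in> B" "w' \<in> C"
    using assms favorite_mem by (auto simp: defs)
  show ?thesis
  proof (cases "x' = x \<or> v' = v \<or> w' = w")
    case True
    \<comment> \<open>If \<open>x' = x\<close>, the cycle starts at \<open>x\<close>. If
      \<open>v' = v\<close> or \<open>w' = w\<close>, then \<open>w' = w\<close> in both cases, and
      the favorite of \<open>w\<close> is \<open>x'\<close>, so the cycle starts at
      \<open>x'\<close>.\<close>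
    then have "favorite G (favorite G (favorite G x)) = x \<or>
        favorite G (favorite G (favorite G x')) = x'"
      unfolding v_def[symmetric] w_def[symmetric] x'_def[symmetric]
        v'_def[symmetric] w'_def[symmetric]
      using True by (metis w'_def w_def x'_def)
    then show ?thesis using favorite_cycle_nearly_content assms mem(3) by blast
  next
    case False
    obtain a where a: "bij_betw a {..<3::nat} A" "a 0 = x" "a 1 = x'"
      using bij_betw_lessThan_3_ex[of A x x'] card_eq assms mem False by auto
    obtain b where b: "bij_betw b {..<3::nat} B" "b 0 = v" "b 1 = v'"
      using bij_betw_lessThan_3_ex[of B v v'] card_eq mem False by auto
    obtain c where c: "bij_betw c {..<3::nat} C" "c 0 = w" "c 1 = w'"
      using bij_betw_lessThan_3_ex[of C w w'] card_eq mem False by auto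
    interpret indexed_market G A B C a b c by unfold_locales (fact a b c)+
    \<comment> \<open>The first two triples follow the path of favorites; only its last arrow out of
      each triple, from \<open>C\<close> to \<open>A\<close>, may leave the triple.\<close>
    have "favorite G (a i) = b i \<and> favorite G (b i) = c i" if "i < 2" for i
      using that a b c less_2_cases[OF that] by (auto simp: defs)
    then have "stable_matching G diagonal"
      by (intro stable_diagonal_two_content) auto
    moreover have "content G diagonal 1 x"
      using content_1_diagonalI[of 0 x] a b by (simp add: triple_def v_def)
    ultimately show ?thesis by (auto simp: nearly_content_def)
  qed
qed

end

theorem theorem7:
  fixes G :: "'v market"
  assumes "circular_market 3 G"
  shows "(\<exists>P. stable_matching G P) \<and>
         (\<forall>x\<in>agents G. \<exists>P. stable_matching G P \<and>
            (content G P 1 x \<or> (content G P 1 (favorite G x) \<and> content G P 2 x)))"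
proof -
  \<comment> \<open>One rotation per gender, so that each agent of the market lies in the first set
    of one of them.\<close>
  interpret W: rotated_market G "women G" "men G" "dogs G"
    by unfold_locales (use assms in auto)
  interpret M: rotated_market G "men G" "dogs G" "women G"
    by unfold_locales (use assms in auto)
  interpret D: rotated_market G "dogs G" "women G" "men G"
    by unfold_locales (use assms in auto)
  have all: "\<exists>P. stable_matching G P \<and>
      (content G P 1 x \<or> (content G P 1 (favorite G x) \<and> content G P 2 x))"
    if "x \<in> agents G" for x
    using that W.nearly_content_ex[of x] M.nearly_content_ex[of x] D.nearly_content_ex[of x]
    by (auto simp: agents_def W.nearly_content_def M.nearly_content_def D.nearly_content_def)
  \<comment> \<open>Plain existence follows by applying the second claim to an arbitrary
    agent.\<close>
  moreover have "agents G \<noteq> {}" using W.card_eq by (auto simp: agents_def)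
  ultimately show ?thesis by blast
qed

end
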